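(* Let $n_1,\ldots,n_N\in S^2$, $c_1,\ldots,c_N>0$, and put $\mu=\frac12\sum_{p=1}^Nc_p(\delta_{n_p}+\delta_{-n_p})$, $M=\sum_{p=1}^Nc_pn_pn_p^T$, $s=\sum_{p=1}^Nc_p$. Suppose that the even weighted measure $\mu$ is invariant under a subgroup $G\subset O(3)$ whose action on $\mathbb{R}^3$ is irreducible. Then $$M=\frac s3I.$$ Consequently, the weighted direction system is a unit-norm tight frame and its degree-two variance contribution $a_2^2\sum_{m=-2}^{2}|\hat\mu_{2m}|^2$ vanishes.
   Context: $I$ is the $3\times3$ identity. The weighted directions form a unit-norm tight frame when $M=\frac s3I$. With $\sigma$ the rotation-invariant probability measure on $S^2$ and $(Y_{lm})$ spherical harmonics orthonormal in $L^2(S^2,\sigma)$, $\hat\mu_{lm}=\int_{S^2}\overline{Y_{lm}(n)}\,d\mu(n)$; $a_2=\frac12\int_{-1}^1|t|P_2(t)\,dt=\frac18$ with $P_2$ the Legendre polynomial. The degree-two variance contribution is the $j=1$ term in $\operatorname{Var}\left(\int_{S^2}|U\cdot n|\,d\mu(n)\right)=\sum_{j\ge1}a_{2j}^2\sum_{m=-2j}^{2j}|\hat\mu_{2j,m}|^2$, where $U$ is uniform on $S^2$ and $a_l=\frac12\int_{-1}^1|t|P_l(t)\,dt$. *)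

theory Defs
  imports "HOL-Probability.Probability" "HOL-Algebra.Group"
    "HOL-Computational_Algebra.Polynomial"
begin

section \<open>Weighted direction systems\<close>

text \<open>
  Directions \<open>n p\<close> and weights \<open>c p\<close> are functions on \<open>nat\<close> of which only the
  values at \<open>p \<in> {1..N}\<close> matter. Measures on the unit sphere are represented as Borel measures on
  \<open>real^3\<close>; integrals over the sphere are set integrals over \<open>sphere 0 1\<close>.
\<close>

definition moment_matrix :: "nat \<Rightarrow> (nat \<Rightarrow> real^3) \<Rightarrow> (nat \<Rightarrow> real) \<Rightarrow> real^3^3" where
  "moment_matrix N n c = (\<Sum>p=1..N. c p *\<^sub>R (\<chi> i j. n p $ i * n p $ j))"

definition total_weight :: "nat \<Rightarrow> (nat \<Rightarrow> real) \<Rightarrow> real" where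
  "total_weight N c = (\<Sum>p=1..N. c p)"

definition even_measure :: "nat \<Rightarrow> (nat \<Rightarrow> real^3) \<Rightarrow> (nat \<Rightarrow> real) \<Rightarrow> (real^3) measure" where
  "even_measure N n c = measure_of UNIV (sets borel)
     (\<lambda>A. \<Sum>p=1..N. ennreal (c p / 2) *
        (emeasure (return borel (n p)) A + emeasure (return borel (- n p)) A))"

lemma sets_even_measure [simp, measurable_cong]: "sets (even_measure N n c) = sets borel"
  unfolding even_measure_def using sets.sets_measure_of_eq[of borel] by simp

lemma space_even_measure [simp]: "space (even_measure N n c) = UNIV"
  by (simp add: even_measure_def space_measure_of_conv)

text \<open>The set function in the definition of \<open>even_measure\<close> is countably additive, so
  \<open>measure_of\<close> does not collapse it to the null measure.\<close>

lemma emeasure_even_measure: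
  assumes "A \<in> sets borel"
  shows "emeasure (even_measure N n c) A = (\<Sum>p=1..N. ennreal (c p / 2) *
           (emeasure (return borel (n p)) A + emeasure (return borel (- n p)) A))"
proof (rule emeasure_measure_of[OF even_measure_def])
  let ?f = "\<lambda>A. \<Sum>p=1..N. ennreal (c p / 2) *
    (emeasure (return borel (n p)) A + emeasure (return borel (- n p)) A)"
  show "sets borel \<subseteq> Pow UNIV" by simp
  show "A \<in> sets (even_measure N n c)" using assms by simp
  show "positive (sets (even_measure N n c)) ?f" by (simp add: positive_def)
  show "countably_additive (sets (even_measure N n c)) ?f"
  proof (rule countably_additiveI)
    fix B :: "nat \<Rightarrow> (real^3) set"
    assume B: "range B \<subseteq> sets (even_measure N n c)" "disjoint_family B"
    have eq: "(\<Sum>i. emeasure (return borel x) (B i)) = emeasure (return borel x) (\<Union> (range B))"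
      for x :: "real^3"
      using B by (intro suminf_emeasure) auto
    show "(\<Sum>i. ?f (B i)) = ?f (\<Union> (range B))"
      by (subst suminf_sum)
        (auto simp: ennreal_suminf_cmult suminf_add[symmetric] eq intro!: sum.cong)
  qed
qed

definition unit_norm_tight_frame :: "nat \<Rightarrow> (nat \<Rightarrow> real^3) \<Rightarrow> (nat \<Rightarrow> real) \<Rightarrow> bool" where
  "unit_norm_tight_frame N n c \<longleftrightarrow>
     (\<forall>p\<in>{1..N}. norm (n p) = 1) \<and> moment_matrix N n c = (total_weight N c / 3) *\<^sub>R mat 1"

lemma moment_matrix_inner:
  "(moment_matrix N n c *v x) \<bullet> y = (\<Sum>p=1..N. c p * (n p \<bullet> x) * (n p \<bullet> y))"
proof -
  have "(moment_matrix N n c *v x) \<bullet> y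
      = (\<Sum>i\<in>UNIV. (\<Sum>j\<in>UNIV. (\<Sum>p=1..N. c p * (n p $ i * n p $ j)) * x $ j) * y $ i)"
    by (simp add: moment_matrix_def inner_vec_def matrix_vector_mult_def)
  also have "\<dots> = (\<Sum>p=1..N. \<Sum>i\<in>UNIV. \<Sum>j\<in>UNIV. c p * (n p $ i * n p $ j) * x $ j * y $ i)"
    by (simp only: sum_distrib_right sum.swap[of _ "{1..N}"])
  also have "\<dots> = (\<Sum>p=1..N. c p * (n p \<bullet> x) * (n p \<bullet> y))"
    by (intro sum.cong refl) (simp add: inner_vec_def sum_3 algebra_simps)
  finally show ?thesis .
qed

text \<open>Agreement with the usual tight frame identity.\<close>

lemma unit_norm_tight_frame_iff:
  "unit_norm_tight_frame N n c \<longleftrightarrow> (\<forall>p\<in>{1..N}. norm (n p) = 1) \<and>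
     (\<forall>x. (\<Sum>p=1..N. c p * (n p \<bullet> x)\<^sup>2) = total_weight N c / 3 * (norm x)\<^sup>2)"
proof -
  let ?M = "moment_matrix N n c" and ?a = "total_weight N c / 3"
  have *: "?M = ?a *\<^sub>R mat 1 \<longleftrightarrow> (\<forall>x. (?M *v x) \<bullet> x = ?a * (x \<bullet> x))"
  proof
    assume "?M = ?a *\<^sub>R mat 1"
    then show "\<forall>x. (?M *v x) \<bullet> x = ?a * (x \<bullet> x)"
      by (simp flip: scaleR_matrix_vector_assoc)
  next
    assume q: "\<forall>x. (?M *v x) \<bullet> x = ?a * (x \<bullet> x)"
    have sym: "(?M *v x) \<bullet> y = (?M *v y) \<bullet> x" for x y
      by (simp add: moment_matrix_inner mult.commute mult.left_commute)
    have "(?M *v x) \<bullet> y = ?a * (x \<bullet> y)" for x y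
    proof -
      have "(?M *v (x + y)) \<bullet> (x + y) = ?a * ((x + y) \<bullet> (x + y))" using q by blast
      then have "2 * ((?M *v x) \<bullet> y) = 2 * (?a * (x \<bullet> y))"
        using q[rule_format, of x] q[rule_format, of y] sym[of x y]
        by (simp add: matrix_vector_right_distrib inner_add_left inner_add_right
            inner_commute[of y x] algebra_simps add_divide_distrib)
      then show ?thesis by simp
    qed
    then have "(?M *v x) \<bullet> y = ((?a *\<^sub>R mat 1) *v x) \<bullet> y" for x y
      by (simp flip: scaleR_matrix_vector_assoc)
    then have "?M *v x = (?a *\<^sub>R mat 1) *v x" for x
      by (metis vector_eq_rdot)
    then show "?M = ?a *\<^sub>R mat 1" by (simp add: matrix_eq)
  qed
  show ?thesis
    unfolding unit_norm_tight_frame_def *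
    by (simp add: moment_matrix_inner power2_eq_square mult.assoc flip: power2_norm_eq_inner)
qed


section \<open>The orthogonal group and its action\<close>

definition O3 :: "(real^3^3) monoid" where
  "O3 = \<lparr>carrier = {A. orthogonal_matrix A}, monoid.mult = (**), one = mat 1\<rparr>"

lemma group_O3: "group O3"
proof (rule groupI)
  fix A assume "A \<in> carrier O3"
  then show "\<exists>B\<in>carrier O3. B \<otimes>\<^bsub>O3\<^esub> A = \<one>\<^bsub>O3\<^esub>"
    by (intro bexI[of _ "transpose A"]) (auto simp: O3_def orthogonal_matrix_def transpose_transpose)
qed (auto simp: O3_def orthogonal_matrix_mul orthogonal_matrix_id matrix_mul_assoc)

definition acts_irreducibly :: "(real^3^3) set \<Rightarrow> bool" where
  "acts_irreducibly G \<longleftrightarrow>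
     (\<forall>V. subspace V \<and> (\<forall>g\<in>G. \<forall>v\<in>V. g *v v \<in> V) \<longrightarrow> V = {0} \<or> V = UNIV)"

definition invariant_under :: "(real^3^3) set \<Rightarrow> (real^3) measure \<Rightarrow> bool" where
  "invariant_under G \<mu> \<longleftrightarrow> (\<forall>g\<in>G. distr \<mu> borel (\<lambda>x. g *v x) = \<mu>)"


section \<open>Spherical harmonics\<close>

definition rotation_invariant_prob :: "(real^3) measure \<Rightarrow> bool" where
  "rotation_invariant_prob \<sigma> \<longleftrightarrow>
     sets \<sigma> = sets borel \<and> prob_space \<sigma> \<and> emeasure \<sigma> (sphere 0 1) = 1 \<and>
     invariant_under {R. rotation_matrix R} \<sigma>"

definition partial_deriv :: "3 \<Rightarrow> (real^3 \<Rightarrow> complex) \<Rightarrow> real^3 \<Rightarrow> complex" where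
  "partial_deriv i f x = vector_derivative (\<lambda>t. f (x + t *\<^sub>R axis i 1)) (at 0)"

definition laplacian :: "(real^3 \<Rightarrow> complex) \<Rightarrow> real^3 \<Rightarrow> complex" where
  "laplacian f x = (\<Sum>i\<in>UNIV. partial_deriv i (partial_deriv i f) x)"

definition solid_harmonic :: "nat \<Rightarrow> (real^3 \<Rightarrow> complex) \<Rightarrow> bool" where
  "solid_harmonic l f \<longleftrightarrow> polynomial_function f \<and>
     (\<forall>t x. f (t *\<^sub>R x) = t ^ l *\<^sub>R f x) \<and> (\<forall>x. laplacian f x = 0)"

definition spherical_harmonic :: "nat \<Rightarrow> (real^3 \<Rightarrow> complex) \<Rightarrow> bool" where
  "spherical_harmonic l Y \<longleftrightarrow> (\<exists>f. solid_harmonic l f \<and> (\<forall>x\<in>sphere 0 1. Y x = f x))"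

text \<open>An arbitrary choice of \<open>2 l + 1\<close> spherical harmonics in each degree \<open>l\<close>, jointly orthonormal;
  the order \<open>m\<close> ranges over \<open>{-l..l}\<close> and other values of \<open>Y l m\<close> are irrelevant.\<close>

definition orthonormal_spherical_harmonics ::
  "(real^3) measure \<Rightarrow> (nat \<Rightarrow> int \<Rightarrow> real^3 \<Rightarrow> complex) \<Rightarrow> bool" where
  "orthonormal_spherical_harmonics \<sigma> Y \<longleftrightarrow>
     (\<forall>l. \<forall>m\<in>{- int l..int l}. spherical_harmonic l (Y l m)) \<and>
     (\<forall>l l'. \<forall>m\<in>{- int l..int l}. \<forall>m'\<in>{- int l'..int l'}.
        (LINT x:sphere 0 1|\<sigma>. Y l m x * cnj (Y l' m' x)) = (if l = l' \<and> m = m' then 1 else 0))"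

definition harmonic_coeff ::
  "(nat \<Rightarrow> int \<Rightarrow> real^3 \<Rightarrow> complex) \<Rightarrow> (real^3) measure \<Rightarrow> nat \<Rightarrow> int \<Rightarrow> complex" where
  "harmonic_coeff Y \<mu> l m = (LINT x:sphere 0 1|\<mu>. cnj (Y l m x))"


section \<open>Legendre coefficients of the absolute value\<close>

text \<open>Rodrigues' formula.\<close>

definition legendre_poly :: "nat \<Rightarrow> real poly" where
  "legendre_poly l = smult (1 / (2 ^ l * fact l)) ((pderiv ^^ l) ([:-1, 0, 1:] ^ l))"

definition abs_coeff :: "nat \<Rightarrow> real" where
  "abs_coeff l = 1 / 2 * integral {-1..1} (\<lambda>t. \<bar>t\<bar> * poly (legendre_poly l) t)"

lemma abs_coeff_2: "abs_coeff 2 = 1 / 8"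
proof -
  have P: "poly (legendre_poly 2) t = (3 * t\<^sup>2 - 1) / 2" for t
    by (simp add: legendre_poly_def numeral_2_eq_2 pderiv_pCons power2_eq_square field_simps)
  have "((\<lambda>t::real. \<bar>t\<bar> * ((3 * t\<^sup>2 - 1) / 2)) has_integral
      ((3 * 1 ^ 4 / 8 - 1\<^sup>2 / 4) - (3 * 0 ^ 4 / 8 - 0\<^sup>2 / 4))) {0..1}"
    by (rule fundamental_theorem_of_calculus)
      (auto intro!: derivative_eq_intros
        simp: has_real_derivative_iff_has_vector_derivative[symmetric] power2_eq_square power3_eq_cube field_simps)
  moreover have "((\<lambda>t::real. \<bar>t\<bar> * ((3 * t\<^sup>2 - 1) / 2)) has_integral
      ((0\<^sup>2 / 4 - 3 * 0 ^ 4 / 8) - ((-1)\<^sup>2 / 4 - 3 * (-1) ^ 4 / 8))) {-1..0}"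
    by (rule fundamental_theorem_of_calculus)
      (auto intro!: derivative_eq_intros
        simp: has_real_derivative_iff_has_vector_derivative[symmetric] power2_eq_square power3_eq_cube field_simps)
  ultimately have "((\<lambda>t::real. \<bar>t\<bar> * ((3 * t\<^sup>2 - 1) / 2)) has_integral 1 / 4) {-1..1}"
    using has_integral_combine[of "-1" 0 1 "\<lambda>t::real. \<bar>t\<bar> * ((3 * t\<^sup>2 - 1) / 2)" "1/8" "1/8"]
    by simp
  from integral_unique[OF this] show ?thesis
    unfolding abs_coeff_def P by linarith
qed

end

theory Submission
  imports Defs
begin

text \<open>
  Invariance of \<open>\<mu>\<close> makes \<open>M\<close>, as a second moment of \<open>\<mu>\<close>, commute with every element of \<open>G\<close>.
  A maximiser of the quadratic form of \<open>M\<close> on the unit sphere is an eigenvector, and its eigenspace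
  is \<open>G\<close>-invariant; by irreducibility \<open>M\<close> is scalar, and the trace of \<open>M\<close> is \<open>s\<close>. A solid
  harmonic of degree two is a quadratic form with a traceless coefficient matrix, so its integral
  against \<open>\<mu>\<close> pairs that matrix with the scalar matrix \<open>M\<close> and vanishes.
\<close>

section \<open>Symmetric operators\<close>

text \<open>Rayleigh quotient argument: if \<open>l\<close> is the maximum of
  \<open>f x \<bullet> x\<close> on the unit sphere, attained at \<open>v\<close>, then
  \<open>l *\<^sub>R x - f x\<close> defines a positive semidefinite operator whose form vanishes at
  \<open>v\<close>, and such an operator annihilates \<open>v\<close>.\<close>

lemma self_adjoint_eigenvector:
  fixes f :: "'a::euclidean_space \<Rightarrow> 'a"
  assumes lin: "linear f" and sym: "\<And>x y. f x \<bullet> y = x \<bullet> f y"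
  obtains v l where "norm v = 1" "f v = l *\<^sub>R v"
proof -
  interpret linear f by fact
  have "continuous_on (sphere 0 1) (\<lambda>x. f x \<bullet> x)"
    by (intro continuous_intros linear_continuous_on lin[unfolded linear_conv_bounded_linear])
  moreover have "sphere 0 1 \<noteq> ({} :: 'a set)"
    by (metis empty_iff mem_sphere_0 SOME_Basis norm_Basis)
  ultimately obtain v where v: "v \<in> sphere 0 1"
    and max: "\<And>x. x \<in> sphere 0 1 \<Longrightarrow> f x \<bullet> x \<le> f v \<bullet> v"
    using continuous_attains_sup[OF compact_sphere] by blast
  define l where "l = f v \<bullet> v"
  define h where "h = (\<lambda>x. l *\<^sub>R x - f x)"
  have nv: "norm v = 1" using v by simp
  have pos: "0 \<le> h x \<bullet> x" for x
  proof (cases "x = 0")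
    case False
    then have "f (x /\<^sub>R norm x) \<bullet> (x /\<^sub>R norm x) \<le> l"
      unfolding l_def by (intro max) simp
    then have "f x \<bullet> x \<le> l * (norm x)\<^sup>2"
      using False by (simp add: scale field_simps power2_eq_square)
    then show ?thesis by (simp add: h_def inner_diff_left power2_norm_eq_inner)
  qed (simp add: h_def)
  have hv: "h v \<bullet> v = 0"
    using nv by (simp add: h_def l_def inner_diff_left norm_eq_1)
  \<comment> \<open>\<open>h\<close> is positive semidefinite, so its form at \<open>v - t h v\<close> is nonnegative; the term linear
     in \<open>t\<close> forces \<open>h v = 0\<close>.\<close>
  have "h v = 0"
  proof (rule ccontr)
    assume nz: "h v \<noteq> 0"
    define w a b where "w = h v" and "a = w \<bullet> w" and "b = h w \<bullet> w"
    have a: "a > 0" and b: "b \<ge> 0" using nz pos by (auto simp: a_def b_def w_def)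
    have hs: "h x \<bullet> y = x \<bullet> h y" for x y
      by (simp add: h_def inner_diff_left inner_diff_right sym)
    have *: "0 \<le> - 2 * t * a + t\<^sup>2 * b" for t
    proof -
      have "h (x - t *\<^sub>R y) = h x - t *\<^sub>R h y" for x y
        by (simp add: h_def diff scale algebra_simps)
      then have hvw: "h (v - t *\<^sub>R w) = w - t *\<^sub>R h w" by (simp add: w_def)
      have "h (v - t *\<^sub>R w) \<bullet> (v - t *\<^sub>R w) = - 2 * t * a + t\<^sup>2 * b"
        using hv hs[of w v] unfolding hvw
        by (simp add: a_def b_def w_def[symmetric] inner_diff_left inner_diff_right
            power2_eq_square algebra_simps)
      then show ?thesis using pos[of "v - t *\<^sub>R w"] by simp
    qed
    \<comment> \<open>The quadratic in \<open>t\<close> is negative for small positive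
      \<open>t\<close>. Its minimiser \<open>a / b\<close> is undefined when \<open>b = 0\<close>,
      whereas \<open>a / (b + 1)\<close> is always positive and small enough.\<close>
    have "0 \<le> - 2 * (a / (b + 1)) * a + (a / (b + 1))\<^sup>2 * b" by (rule *)
    also have "\<dots> = a\<^sup>2 / (b + 1) * (b / (b + 1) - 2)"
      by (simp add: power2_eq_square algebra_simps)
    also have "\<dots> < 0" using a b by (intro mult_pos_neg) (auto simp: field_simps)
    finally show False by simp
  qed
  then have "f v = l *\<^sub>R v" by (simp add: h_def)
  with nv that show ?thesis by blast
qed

text \<open>A real form of Schur's lemma. Symmetry supplies a real eigenvalue; its eigenspace is
  nonzero and, since \<open>A\<close> commutes with \<open>G\<close>, invariant, hence the whole
  space. The trace then identifies the eigenvalue.\<close>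

lemma irreducible_commuting_symmetric_scalar:
  fixes A :: "real^3^3"
  assumes irr: "acts_irreducibly G"
    and comm: "\<And>g x. g \<in> G \<Longrightarrow> A *v (g *v x) = g *v (A *v x)"
    and sym: "\<And>x y. (A *v x) \<bullet> y = x \<bullet> (A *v y)"
  shows "A = (trace A / 3) *\<^sub>R mat 1"
proof -
  obtain v l where v: "norm v = 1" "A *v v = l *\<^sub>R v"
    using self_adjoint_eigenvector[of "(*v) A"] sym by auto
  define V where "V = {x. A *v x = l *\<^sub>R x}"
  have "subspace V"
    by (auto simp: V_def subspace_def matrix_vector_right_distrib scaleR_right_distrib
        matrix_vector_mult_scaleR)
  moreover have "g *v x \<in> V" if "g \<in> G" "x \<in> V" for g x
    using that by (simp add: V_def comm matrix_vector_mult_scaleR)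
  ultimately have "V = {0} \<or> V = UNIV"
    using irr unfolding acts_irreducibly_def by blast
  moreover have "v \<in> V" "v \<noteq> 0" using v by (auto simp: V_def)
  ultimately have "A *v x = l *\<^sub>R x" for x unfolding V_def by blast
  then have "A *v x = (l *\<^sub>R mat 1) *v x" for x
    by (simp flip: scaleR_matrix_vector_assoc)
  then have A: "A = l *\<^sub>R mat 1" by (simp add: matrix_eq)
  then have "trace A = 3 * l" by (simp add: trace_def mat_def sum_3)
  with A show ?thesis by simp
qed


section \<open>Integration against the even measure\<close>

text \<open>Realises the measure as the image of a finite point measure, which reduces integrals to
  finite sums. The point measure lives on indices paired with a sign, not on vectors, so coinciding
  or antipodal directions keep separate weights.\<close>

lemma even_measure_eq_distr:
  assumes "\<And>p. p \<in> {1..N} \<Longrightarrow> c p \<ge> 0"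
  shows "even_measure N n c =
    distr (point_measure ({1..N} \<times> UNIV) (\<lambda>(p, b). ennreal (c p / 2))) borel
      (\<lambda>(p, b). if b then n p else - n p)"
    (is "_ = distr ?P borel ?h")
proof (rule measure_eqI)
  fix A assume "A \<in> sets (even_measure N n c)"
  then have A: "A \<in> sets borel" by simp
  let ?S = "{1..N} \<times> (UNIV :: bool set)"
  have "emeasure (distr ?P borel ?h) A = emeasure ?P (?h -` A \<inter> ?S)"
    using A by (subst emeasure_distr) (auto simp: space_point_measure)
  also have "\<dots> = (\<Sum>x\<in>?h -` A \<inter> ?S. case x of (p, b) \<Rightarrow> ennreal (c p / 2))"
    by (subst emeasure_point_measure_finite) auto
  also have "\<dots> = (\<Sum>x\<in>?S. case x of (p, b) \<Rightarrow> ennreal (c p / 2) * indicator A (?h (p, b)))"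
    by (rule sum.mono_neutral_cong_left) (auto simp: indicator_def split: if_splits)
  also have "\<dots> = (\<Sum>p=1..N. \<Sum>b\<in>UNIV. ennreal (c p / 2) * indicator A (?h (p, b)))"
    by (subst sum.cartesian_product) simp
  also have "\<dots> = emeasure (even_measure N n c) A"
    using A by (simp add: UNIV_bool emeasure_even_measure distrib_left add.commute
        del: sum_mult_indicator)
  finally show "emeasure (even_measure N n c) A = emeasure (distr ?P borel ?h) A" by simp
qed simp

lemma integral_even_measure:
  fixes f :: "real^3 \<Rightarrow> 'b::{banach, second_countable_topology}"
  assumes "\<And>p. p \<in> {1..N} \<Longrightarrow> c p \<ge> 0" and f: "f \<in> borel_measurable borel"
  shows "integral\<^sup>L (even_measure N n c) f = (\<Sum>p=1..N. (c p / 2) *\<^sub>R (f (n p) + f (- n p)))"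
proof -
  let ?S = "{1..N} \<times> (UNIV :: bool set)"
  let ?w = "\<lambda>x :: nat \<times> bool. c (fst x) / 2"
  have "integral\<^sup>L (even_measure N n c) f
      = integral\<^sup>L (point_measure ?S (\<lambda>x. ennreal (?w x)))
          (\<lambda>x. f (case x of (p, b) \<Rightarrow> if b then n p else - n p))"
    by (subst even_measure_eq_distr, fact assms(1), subst integral_distr)
      (auto simp: f case_prod_unfold)
  also have "\<dots> = (\<Sum>x\<in>?S. ?w x *\<^sub>R f (case x of (p, b) \<Rightarrow> if b then n p else - n p))"
    \<comment> \<open>Nonnegative weights survive the passage through \<open>ennreal\<close>, which
      would send negative ones to 0.\<close>
    using assms(1) by (intro lebesgue_integral_point_measure_finite) auto
  also have "\<dots> = (\<Sum>p=1..N. \<Sum>b\<in>UNIV. (c p / 2) *\<^sub>R f (if b then n p else - n p))"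
    by (subst sum.cartesian_product) (simp add: case_prod_unfold)
  finally show ?thesis by (simp add: UNIV_bool scaleR_right_distrib add.commute)
qed

lemma integral_even_measure_even:
  fixes f :: "real^3 \<Rightarrow> 'b::{banach, second_countable_topology}"
  assumes "\<And>p. p \<in> {1..N} \<Longrightarrow> c p \<ge> 0" "f \<in> borel_measurable borel" "\<And>x. f (- x) = f x"
  shows "integral\<^sup>L (even_measure N n c) f = (\<Sum>p=1..N. c p *\<^sub>R f (n p))"
  by (subst integral_even_measure, fact assms(1), fact assms(2))
    (simp add: assms(3) flip: scaleR_2)

text \<open>The bilinear form of the moment matrix is the second moment of \<mu>, so substituting
  \<open>g *v u\<close> for \<open>u\<close> in the integral turns invariance of \<mu> into
  commutation with \<open>g\<close>.\<close>

lemma moment_matrix_commute: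
  assumes c: "\<And>p. p \<in> {1..N} \<Longrightarrow> c p \<ge> 0"
    and orth: "orthogonal_matrix g"
    and inv: "distr (even_measure N n c) borel ((*v) g) = even_measure N n c"
  shows "moment_matrix N n c *v (g *v x) = g *v (moment_matrix N n c *v x)"
proof -
  let ?M = "moment_matrix N n c" and ?\<mu> = "even_measure N n c"
  have meas [measurable]: "(*v) g \<in> borel_measurable borel"
    by (intro borel_measurable_continuous_onI linear_continuous_on
        matrix_vector_mul_bounded_linear)
  have gt: "transpose g *v (g *v z) = z" for z
    using orth by (simp add: matrix_vector_mul_assoc orthogonal_matrix)
  have adj: "(g *v u) \<bullet> w = u \<bullet> (transpose g *v w)" for u w
    by (metis dot_lmul_matrix inner_commute transpose_matrix_vector)
  \<comment> \<open>The integrand is even in \<open>u\<close>, so the two antipodal halves of \<mu>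
    contribute equally.\<close>
  have form: "(?M *v z) \<bullet> w = (\<integral>u. (u \<bullet> z) * (u \<bullet> w) \<partial>?\<mu>)" for z w
    by (subst integral_even_measure_even) (auto simp: c moment_matrix_inner mult.assoc)
  have "(?M *v (g *v x)) \<bullet> y = (g *v (?M *v x)) \<bullet> y" for y
  proof -
    have "(?M *v (g *v x)) \<bullet> y = (\<integral>u. (u \<bullet> (g *v x)) * (u \<bullet> y) \<partial>distr ?\<mu> borel ((*v) g))"
      by (simp add: form inv)
    also have "\<dots> = (\<integral>u. ((g *v u) \<bullet> (g *v x)) * ((g *v u) \<bullet> y) \<partial>?\<mu>)"
      by (subst integral_distr) (auto simp: measurable_cong_sets[OF sets_even_measure refl])
    \<comment> \<open>Orthogonality cancels \<open>g\<close> in the first factor; in the second,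
      \<open>g\<close> moves to \<open>y\<close> as its transpose.\<close>
    also have "\<dots> = (?M *v x) \<bullet> (transpose g *v y)"
      by (simp add: adj gt form del: transpose_matrix_vector)
    also have "\<dots> = (g *v (?M *v x)) \<bullet> y" by (simp only: adj)
    finally show ?thesis .
  qed
  then show ?thesis by (metis vector_eq_rdot)
qed

lemma trace_moment_matrix:
  assumes "\<And>p. p \<in> {1..N} \<Longrightarrow> n p \<in> sphere 0 1"
  shows "trace (moment_matrix N n c) = total_weight N c"
proof -
  have "trace (moment_matrix N n c) = (\<Sum>p=1..N. \<Sum>i\<in>UNIV. c p * (n p $ i * n p $ i))"
    by (simp add: trace_def moment_matrix_def) (rule sum.swap)
  also have "\<dots> = (\<Sum>p=1..N. c p * (n p \<bullet> n p))"
    by (simp add: inner_vec_def sum_distrib_left)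
  also have "\<dots> = total_weight N c"
    unfolding total_weight_def using assms by (intro sum.cong) (auto simp: norm_eq_1)
  finally show ?thesis .
qed

lemma invariant_moment_matrix_scalar:
  assumes "\<And>p. p \<in> {1..N} \<Longrightarrow> n p \<in> sphere 0 1"
    and "\<And>p. p \<in> {1..N} \<Longrightarrow> c p \<ge> 0"
    and "G \<subseteq> {A. orthogonal_matrix A}" "acts_irreducibly G"
    and "invariant_under G (even_measure N n c)"
  shows "moment_matrix N n c = (total_weight N c / 3) *\<^sub>R mat 1"
proof -
  have "moment_matrix N n c = (trace (moment_matrix N n c) / 3) *\<^sub>R mat 1"
  proof (rule irreducible_commuting_symmetric_scalar[OF assms(4)])
    show "moment_matrix N n c *v (g *v x) = g *v (moment_matrix N n c *v x)" if "g \<in> G" for g x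
      using that assms by (intro moment_matrix_commute) (auto simp: invariant_under_def)
    show "(moment_matrix N n c *v x) \<bullet> y = x \<bullet> (moment_matrix N n c *v y)" for x y
      by (simp add: moment_matrix_inner inner_commute[of x] mult.commute mult.left_commute)
  qed
  moreover have "trace (moment_matrix N n c) = total_weight N c"
    by (rule trace_moment_matrix) (fact assms(1))
  ultimately show ?thesis by simp
qed


section \<open>Solid harmonics of degree two\<close>

text \<open>Carrying the constant and linear coefficients along is what makes the induction go through
  products.\<close>

lemma real_polynomial_function_line:
  fixes g :: "real^'n \<Rightarrow> real"
  assumes "real_polynomial_function g"
  shows "\<exists>P a u A. (\<forall>x t. g (t *\<^sub>R x) = poly (P x) t) \<and> (\<forall>x. coeff (P x) 0 = a) \<and>
    (\<forall>x. coeff (P x) 1 = (\<Sum>i\<in>UNIV. u i * x $ i)) \<and>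
    (\<forall>x. coeff (P x) 2 = (\<Sum>i\<in>UNIV. \<Sum>j\<in>UNIV. A i j * (x $ i * x $ j)))"
  using assms
proof induction
  case (linear f)
  then interpret bounded_linear f .
  have f: "f x = (\<Sum>i\<in>UNIV. f (axis i 1) * x $ i)" for x
    by (subst basis_expansion[symmetric, of x])
      (simp add: sum scale scalar_mult_eq_scaleR mult.commute)
  show ?case
    by (rule exI[of _ "\<lambda>x. [:0, f x:]"], rule exI[of _ 0],
        rule exI[of _ "\<lambda>i. f (axis i 1)"], rule exI[of _ "\<lambda>_ _. 0"])
      (auto simp: scale numeral_2_eq_2 f[symmetric])
next
  case (const k)
  show ?case
    by (rule exI[of _ "\<lambda>x. [:k:]"], rule exI[of _ k],
        rule exI[of _ "\<lambda>_. 0"], rule exI[of _ "\<lambda>_ _. 0"]) (auto simp: numeral_2_eq_2)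
next
  case (add f g)
  then obtain P a u A P' a' u' A' where
    "\<forall>x t. f (t *\<^sub>R x) = poly (P x) t" "\<forall>x. coeff (P x) 0 = a"
    "\<forall>x. coeff (P x) 1 = (\<Sum>i\<in>UNIV. u i * x $ i)"
    "\<forall>x. coeff (P x) 2 = (\<Sum>i\<in>UNIV. \<Sum>j\<in>UNIV. A i j * (x $ i * x $ j))"
    "\<forall>x t. g (t *\<^sub>R x) = poly (P' x) t" "\<forall>x. coeff (P' x) 0 = a'"
    "\<forall>x. coeff (P' x) 1 = (\<Sum>i\<in>UNIV. u' i * x $ i)"
    "\<forall>x. coeff (P' x) 2 = (\<Sum>i\<in>UNIV. \<Sum>j\<in>UNIV. A' i j * (x $ i * x $ j))"
    by blast
  then show ?case
    by (intro exI[of _ "\<lambda>x. P x + P' x"] exI[of _ "a + a'"] exI[of _ "\<lambda>i. u i + u' i"]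
        exI[of _ "\<lambda>i j. A i j + A' i j"]) (simp add: sum.distrib distrib_right)
next
  case (mult f g)
  then obtain P a u A P' a' u' A' where *:
    "\<forall>x t. f (t *\<^sub>R x) = poly (P x) t" "\<forall>x. coeff (P x) 0 = a"
    "\<forall>x. coeff (P x) 1 = (\<Sum>i\<in>UNIV. u i * x $ i)"
    "\<forall>x. coeff (P x) 2 = (\<Sum>i\<in>UNIV. \<Sum>j\<in>UNIV. A i j * (x $ i * x $ j))"
    "\<forall>x t. g (t *\<^sub>R x) = poly (P' x) t" "\<forall>x. coeff (P' x) 0 = a'"
    "\<forall>x. coeff (P' x) 1 = (\<Sum>i\<in>UNIV. u' i * x $ i)"
    "\<forall>x. coeff (P' x) 2 = (\<Sum>i\<in>UNIV. \<Sum>j\<in>UNIV. A' i j * (x $ i * x $ j))"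
    by blast
  have c1: "coeff (P x * P' x) 1 = (\<Sum>i\<in>UNIV. (a * u' i + a' * u i) * x $ i)" for x
    using * by (simp add: coeff_mult sum.distrib sum_distrib_left algebra_simps)
  \<comment> \<open>In the Cauchy product, the product of the two linear coefficients is a quadratic
    form with matrix \<open>u i * u' j\<close>, in general not symmetric.\<close>
  have c2: "coeff (P x * P' x) 2 =
      (\<Sum>i\<in>UNIV. \<Sum>j\<in>UNIV. (a * A' i j + u i * u' j + a' * A i j) * (x $ i * x $ j))" for x
  proof -
    have "coeff (P x * P' x) 2 = a * coeff (P' x) 2 + coeff (P x) 1 * coeff (P' x) 1
        + a' * coeff (P x) 2"
      using * by (simp add: coeff_mult numeral_2_eq_2)
    also have "coeff (P x) 1 * coeff (P' x) 1
        = (\<Sum>i\<in>UNIV. \<Sum>j\<in>UNIV. u i * u' j * (x $ i * x $ j))"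
      unfolding *[rule_format] sum_product by (simp only: mult_ac)
    finally show ?thesis
      using * by (simp add: sum.distrib sum_distrib_left algebra_simps)
  qed
  show ?case
    using * c1 c2
    by (intro exI[of _ "\<lambda>x. P x * P' x"] exI[of _ "a * a'"] exI[of _ "\<lambda>i. a * u' i + a' * u i"]
        exI[of _ "\<lambda>i j. a * A' i j + u i * u' j + a' * A i j"]) (simp add: coeff_mult_0)
qed

text \<open>Along each line through the origin, homogeneity forces the restriction of
  \<open>g\<close> to be the monomial \<open>g x * t\<^sup>2\<close>, so \<open>g x\<close> is
  exactly its quadratic coefficient.\<close>

lemma homogeneous_quadratic_form:
  fixes g :: "real^'n \<Rightarrow> real"
  assumes "real_polynomial_function g" and hom: "\<And>t x. g (t *\<^sub>R x) = t\<^sup>2 * g x"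
  obtains A where "\<And>x. g x = (\<Sum>i\<in>UNIV. \<Sum>j\<in>UNIV. A i j * (x $ i * x $ j))"
proof -
  obtain P A where P: "\<And>x t. g (t *\<^sub>R x) = poly (P x) t"
    and A: "\<And>x. coeff (P x) 2 = (\<Sum>i\<in>UNIV. \<Sum>j\<in>UNIV. A i j * (x $ i * x $ j))"
    using real_polynomial_function_line[OF assms(1)] by blast
  have "poly (P x) = poly (monom (g x) 2)" for x
    by (rule ext) (simp add: P[symmetric] hom poly_monom)
  then have "P x = monom (g x) 2" for x by (simp only: poly_eq_poly_eq_iff)
  then have "g x = coeff (P x) 2" for x by simp
  with A that show ?thesis by simp
qed

lemma partial_deriv_quadratic_form:
  fixes A :: "3 \<Rightarrow> 3 \<Rightarrow> complex"
  shows "partial_deriv k (\<lambda>x. \<Sum>i\<in>UNIV. \<Sum>j\<in>UNIV. A i j * of_real (x $ i * x $ j))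
    = (\<lambda>x. \<Sum>i\<in>UNIV. (A i k + A k i) * of_real (x $ i))"
proof
  fix x :: "real^3"
  let ?q = "\<lambda>x :: real^3. \<Sum>i\<in>UNIV. \<Sum>j\<in>UNIV. A i j * of_real (x $ i * x $ j)"
  \<comment> \<open>Exact second-order expansion along a coordinate axis; the coefficient of
    \<open>t\<close> is the partial derivative. Both \<open>A i k\<close> and \<open>A k i\<close>
    occur because \<open>A\<close> may be asymmetric.\<close>
  have "?q (x + t *\<^sub>R axis k 1)
      = ?q x + of_real t * (\<Sum>i\<in>UNIV. (A i k + A k i) * of_real (x $ i)) + of_real (t * t) * A k k" for t
    using exhaust_3[of k] by (auto simp: sum_3 axis_def algebra_simps)
  then show "partial_deriv k ?q x = (\<Sum>i\<in>UNIV. (A i k + A k i) * of_real (x $ i))"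
    unfolding partial_deriv_def
    by (intro vector_derivative_at) (auto intro!: derivative_eq_intros simp del: of_real_mult)
qed

lemma partial_deriv_linear_form:
  fixes u :: "3 \<Rightarrow> complex"
  shows "partial_deriv k (\<lambda>x. \<Sum>i\<in>UNIV. u i * of_real (x $ i)) = (\<lambda>x. u k)"
proof
  fix x :: "real^3"
  let ?q = "\<lambda>x :: real^3. \<Sum>i\<in>UNIV. u i * of_real (x $ i)"
  have "?q (x + t *\<^sub>R axis k 1) = ?q x + of_real t * u k" for t
    using exhaust_3[of k] by (auto simp: sum_3 axis_def algebra_simps)
  then show "partial_deriv k ?q x = u k"
    unfolding partial_deriv_def
    by (intro vector_derivative_at) (auto intro!: derivative_eq_intros)
qed

text \<open>Real and imaginary parts are real quadratic forms and combine into one complex matrix.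
  The Laplacian of the resulting form is the constant \<open>2 * (\<Sum>i\<in>UNIV. A i i)\<close>,
  so its value at the origin already gives the trace condition.\<close>

lemma solid_harmonic_2_quadratic_form:
  assumes "solid_harmonic 2 f"
  obtains A where "\<And>x. f x = (\<Sum>i\<in>UNIV. \<Sum>j\<in>UNIV. A i j * of_real (x $ i * x $ j))"
    and "(\<Sum>i\<in>UNIV. A i i) = 0"
proof -
  have pf: "polynomial_function f" and hom: "\<And>t x. f (t *\<^sub>R x) = t\<^sup>2 *\<^sub>R f x"
    and harm: "\<And>x. laplacian f x = 0"
    using assms by (auto simp: solid_harmonic_def)
  have "real_polynomial_function (\<lambda>x. Re (f x))"
    using pf bounded_linear_Re by (auto simp: polynomial_function_def o_def)
  then obtain B where B: "\<And>x. Re (f x) = (\<Sum>i\<in>UNIV. \<Sum>j\<in>UNIV. B i j * (x $ i * x $ j))"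
    by (rule homogeneous_quadratic_form) (auto simp: hom)
  have "real_polynomial_function (\<lambda>x. Im (f x))"
    using pf bounded_linear_Im by (auto simp: polynomial_function_def o_def)
  then obtain C where C: "\<And>x. Im (f x) = (\<Sum>i\<in>UNIV. \<Sum>j\<in>UNIV. C i j * (x $ i * x $ j))"
    by (rule homogeneous_quadratic_form) (auto simp: hom)
  define A where "A i j = Complex (B i j) (C i j)" for i j
  have f: "f x = (\<Sum>i\<in>UNIV. \<Sum>j\<in>UNIV. A i j * of_real (x $ i * x $ j))" for x
    by (rule complex_eqI) (simp_all add: A_def B C)
  then have fA: "f = (\<lambda>x. \<Sum>i\<in>UNIV. \<Sum>j\<in>UNIV. A i j * of_real (x $ i * x $ j))" ..
  have "laplacian f 0 = (\<Sum>k\<in>UNIV. A k k + A k k)"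
    unfolding laplacian_def fA partial_deriv_quadratic_form partial_deriv_linear_form ..
  then have "2 * (\<Sum>k\<in>UNIV. A k k) = 0"
    using harm[of 0] by (simp add: sum_distrib_left)
  with f that show ?thesis by simp
qed

lemma harmonic_coeff_2_eq_0:
  assumes n: "\<And>p. p \<in> {1..N} \<Longrightarrow> n p \<in> sphere 0 1"
    and c: "\<And>p. p \<in> {1..N} \<Longrightarrow> c p \<ge> 0"
    and M: "moment_matrix N n c = a *\<^sub>R mat 1"
    and Y: "spherical_harmonic 2 (Y 2 m)"
  shows "harmonic_coeff Y (even_measure N n c) 2 m = 0"
proof -
  obtain f where f: "solid_harmonic 2 f" and Yf: "\<And>x. x \<in> sphere 0 1 \<Longrightarrow> Y 2 m x = f x"
    using Y unfolding spherical_harmonic_def by blast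
  obtain A where A: "\<And>x. f x = (\<Sum>i\<in>UNIV. \<Sum>j\<in>UNIV. A i j * of_real (x $ i * x $ j))"
    and tr: "(\<Sum>i\<in>UNIV. A i i) = 0"
    using solid_harmonic_2_quadratic_form[OF f] by blast
  have meas [measurable]: "f \<in> borel_measurable borel"
    using f by (intro borel_measurable_continuous_onI continuous_on_polymonial_function)
      (simp add: solid_harmonic_def)
  have [measurable]: "sphere 0 1 \<in> sets (borel :: (real^3) measure)" by simp
  have [measurable]: "cnj \<in> borel_measurable borel"
    by (intro borel_measurable_continuous_onI continuous_intros)
  have M_entry: "of_real (moment_matrix N n c $ i $ j)
      = (\<Sum>p=1..N. of_real (c p * (n p $ i * n p $ j)) :: complex)" for i j
    by (simp add: moment_matrix_def)
  \<comment> \<open>\<open>Y 2 m\<close> is controlled only on the sphere. Cutting off the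
    polynomial \<open>f\<close> there gives the same integrand as a Borel function that is even on
    the whole space.\<close>
  let ?h = "\<lambda>x :: real^3. indicator (sphere 0 1) x *\<^sub>R cnj (f x)"
  have even: "?h (- x) = ?h x" for x by (simp add: A indicator_def)
  have "harmonic_coeff Y (even_measure N n c) 2 m = integral\<^sup>L (even_measure N n c) ?h"
    unfolding harmonic_coeff_def set_lebesgue_integral_def
    by (intro Bochner_Integration.integral_cong) (auto simp: Yf indicator_def)
  also have "\<dots> = (\<Sum>p=1..N. c p *\<^sub>R ?h (n p))"
    using c even by (intro integral_even_measure_even) auto
  also have "\<dots> = cnj (\<Sum>p=1..N. c p *\<^sub>R f (n p))"
    unfolding cnj_sum using n by (intro sum.cong) auto
  also have "(\<Sum>p=1..N. c p *\<^sub>R f (n p))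
      = (\<Sum>p=1..N. \<Sum>i\<in>UNIV. \<Sum>j\<in>UNIV. A i j * of_real (c p * (n p $ i * n p $ j)))"
    by (simp add: A scaleR_conv_of_real sum_distrib_left mult.left_commute)
  also have "\<dots> = (\<Sum>i\<in>UNIV. \<Sum>j\<in>UNIV. A i j * of_real (moment_matrix N n c $ i $ j))"
    by (simp only: M_entry sum_distrib_left sum.swap[of _ UNIV "{1..N}"])
  \<comment> \<open>The scalar matrix has no off-diagonal entries, so the pairing retains only the
    trace of \<open>A\<close>.\<close>
  also have "\<dots> = (\<Sum>i\<in>UNIV. A i i) * of_real a"
    by (simp add: M mat_def sum_3 distrib_right)
  finally show ?thesis by (simp add: tr)
qed

theorem corollaryC2:
  fixes N :: nat and n :: "nat \<Rightarrow> real^3" and c :: "nat \<Rightarrow> real"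
    and G :: "(real^3^3) set"
    and \<sigma> :: "(real^3) measure" and Y :: "nat \<Rightarrow> int \<Rightarrow> real^3 \<Rightarrow> complex"
  assumes "\<And>p. p \<in> {1..N} \<Longrightarrow> n p \<in> sphere 0 1"
    and "\<And>p. p \<in> {1..N} \<Longrightarrow> c p > 0"
    and "subgroup G O3"
    and "acts_irreducibly G"
    and "invariant_under G (even_measure N n c)"
    and "rotation_invariant_prob \<sigma>"
    and "orthonormal_spherical_harmonics \<sigma> Y"
  shows "moment_matrix N n c = (total_weight N c / 3) *\<^sub>R mat 1
    \<and> unit_norm_tight_frame N n c
    \<and> (abs_coeff 2)\<^sup>2 *
        (\<Sum>m=-2..2. (cmod (harmonic_coeff Y (even_measure N n c) 2 m))\<^sup>2) = 0"
proof -
  have c: "\<And>p. p \<in> {1..N} \<Longrightarrow> c p \<ge> 0" using assms(2) by (simp add: less_imp_le)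
  have "G \<subseteq> {A. orthogonal_matrix A}"
    using subgroup.subset[OF assms(3)] by (simp add: O3_def)
  then have M: "moment_matrix N n c = (total_weight N c / 3) *\<^sub>R mat 1"
    using assms c by (intro invariant_moment_matrix_scalar)
  moreover have "harmonic_coeff Y (even_measure N n c) 2 m = 0" if "m \<in> {-2..2}" for m
  proof (rule harmonic_coeff_2_eq_0[OF assms(1) c M])
    have "m \<in> {- int 2..int 2}" using that by simp
    then show "spherical_harmonic 2 (Y 2 m)"
      using assms(7) unfolding orthonormal_spherical_harmonics_def by blast
  qed
  ultimately show ?thesis
    using assms(1) by (simp add: unit_norm_tight_frame_def)
qed

end
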